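(* If $A$, $B$, and $C$ are subsets of a finite abelian group $G$ such that $A+B+C\ne G$, then $$|A|+|B|+|C|\le|G|+|\pi(A+B+C)|.$$
   Context: For a subset $S$ of an abelian group $G$, the period of $S$ is the subgroup $\pi(S)=\{g\in G: S+g=S\}$. Sumsets are $A+B+C=\{a+b+c: a\in A,\ b\in B,\ c\in C\}$. *)

theory Defs
  imports "HOL-Algebra.Coset"
begin

text \<open>
  Abelian groups are written multiplicatively: the sumset \<open>A + B\<close> is \<open>A <#>\<^bsub>G\<^esub> B\<close>
  and the translate \<open>S + g\<close> is \<open>S #>\<^bsub>G\<^esub> g\<close>.
\<close>

definition period :: "('a, 'b) monoid_scheme \<Rightarrow> 'a set \<Rightarrow> 'a set" where
  "period G S = {g \<in> carrier G. S #>\<^bsub>G\<^esub> g = S}"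

lemma (in group) subgroup_period:
  assumes S: "S \<subseteq> carrier G"
  shows "subgroup (period G S) G"
proof (rule subgroupI)
  show "period G S \<subseteq> carrier G"
    by (auto simp: period_def)
  have "\<one> \<in> period G S"
    using S by (simp add: period_def coset_mult_one)
  then show "period G S \<noteq> {}"
    by blast
next
  fix g assume g: "g \<in> period G S"
  then have "S #> inv g = (S #> g) #> inv g"
    by (simp add: period_def)
  also have "\<dots> = S"
    using g coset_mult_assoc[OF S, of g "inv g"] S
    by (simp add: period_def coset_mult_one)
  finally show "inv g \<in> period G S"
    using g by (simp add: period_def)
next
  fix g h assume gh: "g \<in> period G S" "h \<in> period G S"
  then have "S #> (g \<otimes> h) = (S #> g) #> h"
    using coset_mult_assoc[OF S, of g h] by (simp add: period_def)
  with gh show "g \<otimes> h \<in> period G S"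
    by (simp add: period_def)
qed

end

theory Submission
  imports Defs
begin

text \<open>
  The inequality is Kneser's theorem in the form \<open>|A| + |B| \<le> |A + B| + |\<pi>(A + B)|\<close>, for finite nonempty
  sets, used twice. Apply it to the pair \<open>A, B\<close> and then to the pair \<open>A + B, C\<close>. With \<open>H = \<pi>(A + B + C)\<close> this gives
  \<open>|A| + |B| + |C| \<le> |A + B + C| + |H| + |\<pi>(A + B)|\<close>. Periods can only grow when a summand is added, so
  \<open>\<pi>(A + B) \<subseteq> H\<close>. Finally \<open>A + B + C\<close> is a union of cosets of \<open>H\<close> and misses at least one of them,
  so \<open>|A + B + C| + |H| \<le> |G|\<close>.

  Kneser's theorem itself comes from two facts about the weight \<open>w(S) = |S| + |\<pi>(S)|\<close>.
  Every element of \<open>A + B\<close> lies in some subset of \<open>A + B\<close> whose weight is at least \<open>|A| + |B|\<close>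
  (lemma \<open>heavy_subset_of_sumset\<close>, by iterated Dyson transforms), and the weight of a union is at
  least the smaller of the weights of its parts (lemma \<open>weight_Un\<close>, by counting inside one coset of the sum
  of the two periods). As \<open>A + B\<close> is the union of those subsets, its weight is at least \<open>|A| + |B|\<close>.
\<close>

section \<open>Periods of finite sets\<close>

context comm_group
begin

lemma period_subset_carrier: "period G S \<subseteq> carrier G"
  by (auto simp: period_def)

lemma mult_period_closed:
  assumes "g \<in> period G S" "s \<in> S"
  shows "s \<otimes> g \<in> S"
  using assms by (force simp: period_def r_coset_def)

text \<open>For a finite set an inclusion \<open>S + g \<subseteq> S\<close> is an equality, because translation is injective.\<close>

lemma periodI:
  assumes "finite S" "S \<subseteq> carrier G" "g \<in> carrier G" "\<And>s. s \<in> S \<Longrightarrow> s \<otimes> g \<in> S"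
  shows "g \<in> period G S"
proof -
  have "inj_on (\<lambda>s. s \<otimes> g) S"
    using assms(2,3) by (intro inj_onI) (simp add: subset_iff)
  moreover have "(\<lambda>s. s \<otimes> g) ` S \<subseteq> S"
    using assms(4) by auto
  ultimately have "(\<lambda>s. s \<otimes> g) ` S = S"
    using assms(1) by (simp add: endo_inj_surj)
  then show ?thesis
    using assms(3) by (auto simp: period_def r_coset_def)
qed

lemma finite_period:
  assumes "finite S" "S \<subseteq> carrier G" "S \<noteq> {}"
  shows "finite (period G S)"
proof -
  obtain s where s: "s \<in> S" using assms(3) by blast
  have "inj_on (\<lambda>g. s \<otimes> g) (period G S)"
    using s assms(2) period_subset_carrier by (intro inj_onI) (simp add: subset_iff)
  moreover have "(\<lambda>g. s \<otimes> g) ` period G S \<subseteq> S"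
    using s mult_period_closed by blast
  ultimately show ?thesis
    using assms(1) by (meson finite_imageD finite_subset)
qed

lemma card_le_of_translate_subset:
  assumes "finite T" "S \<subseteq> carrier G" "x \<in> carrier G" "\<And>s. s \<in> S \<Longrightarrow> x \<otimes> s \<in> T"
  shows "card S \<le> card T"
proof (rule card_inj_on_le)
  show "inj_on (\<lambda>s. x \<otimes> s) S"
    using assms(2,3) by (intro inj_onI) (simp add: subset_iff)
qed (use assms in auto)

lemma set_mult_mem_iff: "z \<in> S <#> T \<longleftrightarrow> (\<exists>s\<in>S. \<exists>t\<in>T. z = s \<otimes> t)"
  by (auto simp: set_mult_def)

lemma finite_set_mult: "finite S \<Longrightarrow> finite T \<Longrightarrow> finite (S <#> T)"
  by (simp add: set_mult_def)

lemma period_subset_period_set_mult: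
  assumes "finite S" "finite T" "S \<subseteq> carrier G" "T \<subseteq> carrier G"
  shows "period G S \<subseteq> period G (S <#> T)"
proof
  fix g assume g: "g \<in> period G S"
  then have gG: "g \<in> carrier G" using period_subset_carrier by blast
  show "g \<in> period G (S <#> T)"
  proof (rule periodI)
    fix z assume "z \<in> S <#> T"
    then obtain s t where st: "s \<in> S" "t \<in> T" "z = s \<otimes> t"
      by (auto simp: set_mult_mem_iff)
    then have "z \<otimes> g = (s \<otimes> g) \<otimes> t"
      using assms gG by (simp add: subset_iff m_ac)
    then show "z \<otimes> g \<in> S <#> T"
      using mult_period_closed[OF g] st by (auto simp: set_mult_mem_iff)
  qed (use assms gG in \<open>simp_all add: finite_set_mult set_mult_closed\<close>)
qed

section \<open>The weight of a union\<close>

text \<open>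
  A fibre of the multiplication map \<open>U \<times> V \<rightarrow> UV\<close> has at most \<open>|H \<inter> K|\<close> elements: two
  factorisations \<open>uv = u'v'\<close> differ by \<open>u/u' = v'/v\<close>, which lies in both subgroups.
\<close>

lemma card_mult_le_card_set_mult:
  assumes H: "subgroup H G" "finite H" "U \<subseteq> H" and K: "subgroup K G" "finite K" "V \<subseteq> K"
  shows "card U * card V \<le> card (H \<inter> K) * card (U <#> V)"
proof -
  define fib where "fib y = {p \<in> U \<times> V. fst p \<otimes> snd p = y}" for y
  have fin: "finite U" "finite V"
    using H K by (auto intro: finite_subset)
  have HG: "H \<subseteq> carrier G" "K \<subseteq> carrier G"
    using subgroup.subset[OF H(1)] subgroup.subset[OF K(1)] .
  have UV: "U \<times> V = (\<Union>y\<in>U <#> V. fib y)"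
    unfolding fib_def by (auto simp: set_mult_mem_iff) blast
  have fib_le: "card (fib y) \<le> card (H \<inter> K)" for y
  proof (cases "fib y = {}")
    case False
    then obtain u0 v0 where uv0: "u0 \<in> U" "v0 \<in> V" "u0 \<otimes> v0 = y"
      by (auto simp: fib_def)
    have G0: "u0 \<in> carrier G" "v0 \<in> carrier G"
      using uv0 H(3) K(3) HG by auto
    have carr: "u \<in> carrier G" "v \<in> carrier G" if "(u, v) \<in> fib y" for u v
      using that H(3) K(3) HG by (auto simp: fib_def)
    have eq: "u \<otimes> inv u0 = v0 \<otimes> inv v" if "(u, v) \<in> fib y" for u v
    proof -
      have "u \<otimes> v = u0 \<otimes> v0" using that uv0 by (simp add: fib_def)
      moreover have "u = (u \<otimes> v) \<otimes> inv v"
        using carr[OF that] by (simp add: m_assoc)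
      ultimately have "u = u0 \<otimes> v0 \<otimes> inv v"
        by simp
      also have "\<dots> = v0 \<otimes> inv v \<otimes> u0"
        using carr[OF that] G0 by (simp add: m_ac)
      finally show ?thesis
        using carr[OF that] G0 by (simp add: inv_solve_right')
    qed
    show ?thesis
    proof (rule card_inj_on_le)
      show "inj_on (\<lambda>p. fst p \<otimes> inv u0) (fib y)"
      proof (rule inj_onI)
        fix p q
        assume pq: "p \<in> fib y" "q \<in> fib y" and e: "fst p \<otimes> inv u0 = fst q \<otimes> inv u0"
        obtain u v u' v' where p: "p = (u, v)" and q: "q = (u', v')"
          using prod.exhaust by metis
        have "u = u'" using e pq carr G0 by (auto simp: p q)
        moreover have "u \<otimes> v = u' \<otimes> v'" using pq by (simp add: p q fib_def)
        ultimately show "p = q"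
          using carr pq by (auto simp: p q)
      qed
      show "(\<lambda>p. fst p \<otimes> inv u0) ` fib y \<subseteq> H \<inter> K"
      proof (rule image_subsetI)
        fix p assume p: "p \<in> fib y"
        obtain u v where uv: "p = (u, v)" by (rule prod.exhaust)
        have mem: "u \<in> H" "v \<in> K" "u0 \<in> H" "v0 \<in> K"
          using p uv0 H(3) K(3) by (auto simp: uv fib_def)
        have "u \<otimes> inv u0 \<in> H"
          using mem H(1) by (simp add: subgroup.m_closed subgroup.m_inv_closed)
        moreover have "v0 \<otimes> inv v \<in> K"
          using mem K(1) by (simp add: subgroup.m_closed subgroup.m_inv_closed)
        ultimately show "fst p \<otimes> inv u0 \<in> H \<inter> K"
          using eq p by (simp add: uv)
      qed
    qed (use H in simp)
  qed simp
  have "card U * card V = card (\<Union>y\<in>U <#> V. fib y)"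
    by (simp add: UV[symmetric] card_cartesian_product)
  also have "\<dots> \<le> (\<Sum>y\<in>U <#> V. card (fib y))"
    by (rule card_UN_le) (simp add: fin finite_set_mult)
  also have "\<dots> \<le> (\<Sum>y\<in>U <#> V. card (H \<inter> K))"
    by (intro sum_mono fib_le)
  finally show ?thesis by (simp add: mult.commute)
qed

text \<open>
  If \<open>b < a'\<close>, replace \<open>a'\<close> by \<open>b\<close> in the second product, otherwise replace \<open>b\<close> by \<open>a'\<close> in the
  first one. Either way there remains a product of two numbers that are at least \<open>h\<close>, and for fixed sum \<open>n\<close> such
  a product is at least \<open>h(n - h)\<close>.
\<close>

lemma grid_count_arith:
  fixes a a' b b' h P Q :: nat
  assumes "0 < h" "h \<le> a" "h \<le> a'" "h \<le> b" "h \<le> b'"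
    and P: "a * b \<le> h * P" and Q: "a' * b' \<le> h * Q"
  shows "a + a' \<le> P + h \<or> b + b' \<le> Q + h"
proof -
  have sum_le: "s + t \<le> R + h" if st: "h \<le> s" "h \<le> t" "s * t \<le> h * R" for s t R :: nat
  proof -
    obtain i j where ij: "s = h + i" "t = h + j"
      using le_Suc_ex[OF st(1)] le_Suc_ex[OF st(2)] by blast
    have "h * (h + i + j) \<le> s * t"
      by (simp add: ij algebra_simps)
    also note st(3)
    finally show ?thesis
      using assms(1) by (simp add: ij)
  qed
  show ?thesis
  proof (cases "a' \<le> b")
    case True
    then have "a * a' \<le> h * P"
      using P by (meson le_trans mult_le_mono2)
    then show ?thesis using sum_le assms by blast
  next
    case False
    then have "b * b' \<le> h * Q"
      using Q by (meson le_trans mult_le_mono1 nat_le_linear)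
    then show ?thesis using sum_le assms by blast
  qed
qed

text \<open>
  Inside the coset of \<open>H + K\<close> through \<open>x\<close>, where \<open>H\<close> and \<open>K\<close> are the periods of \<open>C\<close> and \<open>D\<close>, the
  cosets of \<open>H\<close> and \<open>K\<close> form the rows and columns of a grid. There \<open>C\<close> is a union of rows and \<open>D\<close> a union
  of columns, so the two differences are products of a set of rows with a set of columns. The
  sets \<open>U\<close> and \<open>V\<close> below record the columns in \<open>D\<close> and the rows outside \<open>C\<close>, so that \<open>D - C\<close> contains
  \<open>x + U + V\<close> and \<open>C - D\<close> contains \<open>x + (H - U) + (K - V)\<close>. If no row lies in \<open>C\<close>, or if every column lies in
  \<open>D\<close>, then \<open>D - C\<close> contains the coset \<open>x + K\<close> or \<open>x + H\<close>. Otherwise \<open>U\<close>, \<open>V\<close> and both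
  complements contain a coset of \<open>H \<inter> K\<close>, and comparing the two products gives one of the other alternatives.
\<close>

lemma card_diff_alternatives:
  assumes C: "finite C" "C \<subseteq> carrier G" "C \<noteq> {}"
    and D: "finite D" "D \<subseteq> carrier G"
    and x: "x \<in> D - C"
  defines "h \<equiv> card (period G C \<inter> period G D)"
  shows "card (period G D) \<le> card (D - C)
    \<or> card (period G C) \<le> card (D - C) + h
    \<or> card (period G D) \<le> card (C - D) + h"
proof -
  define H where "H = period G C"
  define K where "K = period G D"
  define U where "U = {u \<in> H. x \<otimes> u \<in> D}"
  define V where "V = {v \<in> K. x \<otimes> v \<notin> C}"
  have sub: "subgroup H G" "subgroup K G"
    using C D by (simp_all add: H_def K_def subgroup_period)
  have HG: "H \<subseteq> carrier G" and KG: "K \<subseteq> carrier G"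
    by (simp_all add: H_def K_def period_subset_carrier)
  have fin: "finite H" "finite K"
    using C D x by (auto simp: H_def K_def intro!: finite_period)
  have UH: "U \<subseteq> H" and VK: "V \<subseteq> K"
    by (auto simp: U_def V_def)
  have xG: "x \<in> carrier G" using x D by blast
  have Cper: "c \<otimes> u \<in> C \<longleftrightarrow> c \<in> C" if "c \<in> carrier G" "u \<in> H" for c u
  proof
    assume "c \<otimes> u \<in> C"
    moreover have "inv u \<in> period G C"
      using sub that subgroup.m_inv_closed by (auto simp: H_def)
    ultimately have "c \<otimes> u \<otimes> inv u \<in> C"
      by (rule mult_period_closed[rotated])
    then show "c \<in> C"
      using that HG by (simp add: m_assoc subset_iff)
  next
    show "c \<in> C \<Longrightarrow> c \<otimes> u \<in> C"
      using that mult_period_closed by (simp add: H_def)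
  qed
  have Dper: "d \<otimes> v \<in> D \<longleftrightarrow> d \<in> D" if "d \<in> carrier G" "v \<in> K" for d v
  proof
    assume "d \<otimes> v \<in> D"
    moreover have "inv v \<in> period G D"
      using sub that subgroup.m_inv_closed by (auto simp: K_def)
    ultimately have "d \<otimes> v \<otimes> inv v \<in> D"
      by (rule mult_period_closed[rotated])
    then show "d \<in> D"
      using that KG by (simp add: m_assoc subset_iff)
  next
    show "d \<in> D \<Longrightarrow> d \<otimes> v \<in> D"
      using that mult_period_closed by (simp add: K_def)
  qed
  have grid: "x \<otimes> (u \<otimes> v) \<in> C \<longleftrightarrow> x \<otimes> v \<in> C" "x \<otimes> (u \<otimes> v) \<in> D \<longleftrightarrow> x \<otimes> u \<in> D"
    if "u \<in> H" "v \<in> K" for u v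
  proof -
    have uv: "u \<in> carrier G" "v \<in> carrier G" using that HG KG by auto
    have e: "x \<otimes> (u \<otimes> v) = (x \<otimes> v) \<otimes> u" "x \<otimes> (u \<otimes> v) = (x \<otimes> u) \<otimes> v"
      using uv xG by (simp_all add: m_ac)
    show "x \<otimes> (u \<otimes> v) \<in> C \<longleftrightarrow> x \<otimes> v \<in> C"
      unfolding e(1) using Cper that uv xG by simp
    show "x \<otimes> (u \<otimes> v) \<in> D \<longleftrightarrow> x \<otimes> u \<in> D"
      unfolding e(2) using Dper that uv xG by simp
  qed
  have UVG: "U <#> V \<subseteq> carrier G" "(H - U) <#> (K - V) \<subseteq> carrier G"
    using UH VK HG KG by (intro set_mult_closed; blast)+
  have P: "card (U <#> V) \<le> card (D - C)"
    using grid D UVG xG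
    by (intro card_le_of_translate_subset[of _ _ x]) (auto simp: set_mult_mem_iff U_def V_def)
  have Q: "card ((H - U) <#> (K - V)) \<le> card (C - D)"
    using grid C UVG xG
    by (intro card_le_of_translate_subset[of _ _ x]) (auto simp: set_mult_mem_iff U_def V_def)
  have one: "\<one> \<in> H" "\<one> \<in> K"
    using sub subgroup.one_closed by auto
  consider "V = K" | "U = H" | u v where "u \<in> H - U" "v \<in> K - V"
    using UH VK by blast
  then show ?thesis
  proof cases
    case 1
    have "x \<otimes> v \<in> D - C" if "v \<in> K" for v
      using that 1 Dper x xG by (auto simp: V_def)
    then have "card K \<le> card (D - C)"
      using D KG xG by (intro card_le_of_translate_subset[of _ _ x]) auto
    then show ?thesis by (simp add: K_def)
  next
    case 2
    have "x \<otimes> u \<in> D - C" if "u \<in> H" for u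
      using that 2 Cper x xG by (auto simp: U_def)
    then have "card H \<le> card (D - C)"
      using D HG xG by (intro card_le_of_translate_subset[of _ _ x]) auto
    then show ?thesis by (simp add: H_def)
  next
    case 3
    have IG: "H \<inter> K \<subseteq> carrier G" using HG by blast
    have uvG: "u \<in> carrier G" "v \<in> carrier G" using 3 HG KG by auto
    have hdef: "h = card (H \<inter> K)" by (simp add: h_def H_def K_def)
    have "0 < h"
      using fin one by (auto simp: hdef card_gt_0_iff)
    moreover have "h \<le> card U"
      unfolding hdef using Dper x xG fin UH
      by (intro card_mono) (auto simp: U_def intro: finite_subset)
    moreover have "h \<le> card V"
      unfolding hdef using Cper x xG fin VK
      by (intro card_mono) (auto simp: V_def intro: finite_subset)
    moreover have "h \<le> card (H - U)"
      unfolding hdef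
    proof (rule card_le_of_translate_subset[of _ _ u])
      fix k assume k: "k \<in> H \<inter> K"
      then show "u \<otimes> k \<in> H - U"
        using 3 grid(2)[of u k] subgroup.m_closed[OF sub(1)] by (auto simp: U_def)
    qed (use fin IG uvG in auto)
    moreover have "h \<le> card (K - V)"
      unfolding hdef
    proof (rule card_le_of_translate_subset[of _ _ v])
      fix k assume k: "k \<in> H \<inter> K"
      then have "v \<otimes> k = k \<otimes> v" using IG uvG by (auto intro: m_comm)
      then show "v \<otimes> k \<in> K - V"
        using k 3 grid(1)[of k v] subgroup.m_closed[OF sub(2), of k v] by (auto simp: V_def)
    qed (use fin IG uvG in auto)
    moreover have "card U * card V \<le> h * card (D - C)"
      using card_mult_le_card_set_mult[OF sub(1) fin(1) UH sub(2) fin(2) VK] P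
      unfolding hdef by (meson le_trans mult_le_mono2)
    moreover have "card (H - U) * card (K - V) \<le> h * card (C - D)"
      using card_mult_le_card_set_mult[OF sub(1) fin(1) Diff_subset sub(2) fin(2) Diff_subset] Q
      unfolding hdef by (meson le_trans mult_le_mono2)
    ultimately have "card U + card (H - U) \<le> card (D - C) + h
        \<or> card V + card (K - V) \<le> card (C - D) + h"
      by (intro grid_count_arith)
    moreover have "card U + card (H - U) = card H" "card V + card (K - V) = card K"
      using fin UH VK by (metis card_Diff_subset card_mono finite_subset le_add_diff_inverse)+
    ultimately show ?thesis by (auto simp: H_def K_def)
  qed
qed

definition weight :: "'a set \<Rightarrow> nat" where
  "weight S = card S + card (period G S)"

text \<open>
  The alternatives of \<open>card_diff_alternatives\<close>, used from both sides, prove the claim directly unless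
  \<open>|\<pi>(D)| \<le> |D - C|\<close> and \<open>|\<pi>(C)| \<le> |C - D|\<close>. In that case, if \<open>D\<close>, say, has the smaller period, then
  \<open>|C - D| \<ge> |\<pi>(D)|\<close>, so enlarging \<open>D\<close> to the union gains at least as many elements as \<open>D\<close> has periods.
\<close>

lemma weight_Un:
  assumes C: "finite C" "C \<subseteq> carrier G" "C \<noteq> {}"
    and D: "finite D" "D \<subseteq> carrier G" "D \<noteq> {}"
  shows "min (weight C) (weight D) \<le> weight (C \<union> D)"
proof -
  consider "D \<subseteq> C" | "C \<subseteq> D" | x y where "x \<in> D - C" "y \<in> C - D" by blast
  then show ?thesis
  proof cases
    case 3
    define h where "h = card (period G C \<inter> period G D)"
    have "period G C \<inter> period G D \<subseteq> period G (C \<union> D)"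
      using C D by (auto intro!: periodI dest: mult_period_closed simp: subsetD[OF period_subset_carrier])
    then have h: "h \<le> card (period G (C \<union> D))"
      unfolding h_def using C D by (intro card_mono finite_period) auto
    have cards: "card (C \<union> D) = card C + card (D - C)" "card (C \<union> D) = card D + card (C - D)"
      using C D
      by (simp_all add: card_Un_disjoint[symmetric] Un_commute)
    show ?thesis
      using card_diff_alternatives[OF C D(1,2) 3(1)] card_diff_alternatives[OF D C(1,2) 3(2)] h cards
      unfolding weight_def h_def[symmetric] Int_commute[of "period G D"] by linarith
  qed (auto simp: Un_absorb1 Un_absorb2)
qed

lemma weight_Union:
  assumes "finite F" "F \<noteq> {}"
    and "\<And>S. S \<in> F \<Longrightarrow> finite S \<and> S \<subseteq> carrier G \<and> S \<noteq> {} \<and> n \<le> weight S"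
  shows "n \<le> weight (\<Union>F)"
  using assms
proof (induction F rule: finite_ne_induct)
  case (insert S F)
  have "min (weight S) (weight (\<Union>F)) \<le> weight (S \<union> \<Union>F)"
  proof (rule weight_Un)
    show "finite (\<Union>F)"
      using insert.prems insert.hyps(1) by simp
    show "\<Union>F \<subseteq> carrier G"
      using insert.prems by (simp add: Union_least)
    obtain T where "T \<in> F" using insert.hyps(2) by blast
    then show "\<Union>F \<noteq> {}"
      using insert.prems by fastforce
  qed (use insert.prems in simp_all)
  moreover have "n \<le> weight S" "n \<le> weight (\<Union>F)"
    using insert by auto
  ultimately show ?case by simp
qed simp

section \<open>Kneser's theorem\<close>

text \<open>
  A translated Dyson transform: for \<open>e \<in> A\<close> and \<open>t = e - b\<close>, move those elements of \<open>B + t\<close> that are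
  missing from \<open>A\<close> over to \<open>A\<close>, and keep in \<open>B\<close> the others. This preserves \<open>|A| + |B|\<close>, keeps \<open>a \<in> A\<close> and
  \<open>b \<in> B\<close>, and does not enlarge \<open>A + B\<close>. When no transform makes \<open>B\<close> smaller, \<open>A\<close> is stable under adding
  \<open>B - b\<close>. Then \<open>A + b\<close> is the required subset: its period contains \<open>B - b\<close>.
\<close>

lemma heavy_subset_of_sumset:
  assumes "finite A" "A \<subseteq> carrier G" "a \<in> A" "finite B" "B \<subseteq> carrier G" "b \<in> B"
  shows "\<exists>C. C \<subseteq> A <#> B \<and> a \<otimes> b \<in> C \<and> card A + card B \<le> weight C"
  using assms
proof (induction "card B" arbitrary: A B rule: less_induct)
  case less
  note A = less.prems(1-3) and B = less.prems(4-6)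
  have bG: "b \<in> carrier G" using B by blast
  show ?case
  proof (cases "\<forall>e\<in>A. \<forall>f\<in>B. f \<otimes> (e \<otimes> inv b) \<in> A")
    case True
    define C where "C = A #> b"
    have CG: "C \<subseteq> carrier G" and finC: "finite C" and abC: "a \<otimes> b \<in> C"
      using A bG by (auto simp: C_def r_coset_def)
    have "card C = card A"
    proof -
      have "C = (\<lambda>a. a \<otimes> b) ` A" by (auto simp: C_def r_coset_def)
      moreover have "inj_on (\<lambda>a. a \<otimes> b) A"
        using A bG by (intro inj_onI) (simp add: subset_iff)
      ultimately show ?thesis by (simp add: card_image)
    qed
    moreover have "card B \<le> card (period G C)"
    proof (rule card_le_of_translate_subset[of _ _ "inv b"])
      show "finite (period G C)"
        using CG finC abC by (intro finite_period) auto
      fix f assume f: "f \<in> B"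
      then have fG: "f \<in> carrier G" using B by blast
      show "inv b \<otimes> f \<in> period G C"
      proof (rule periodI[OF finC CG])
        fix c assume "c \<in> C"
        then obtain e where e: "e \<in> A" "c = e \<otimes> b"
          by (auto simp: C_def r_coset_def)
        then have eG: "e \<in> carrier G" using A by blast
        have "c \<otimes> (inv b \<otimes> f) = (f \<otimes> (e \<otimes> inv b)) \<otimes> b"
          using e eG fG bG by (simp add: m_ac)
        then show "c \<otimes> (inv b \<otimes> f) \<in> C"
          using True e f by (auto simp: C_def r_coset_def)
      qed (use fG bG in simp)
    qed (use B bG in auto)
    moreover have "C \<subseteq> A <#> B"
      using B(3) unfolding C_def r_coset_def set_mult_def by blast
    ultimately show ?thesis
      using abC by (intro exI[of _ C]) (simp add: weight_def)
  next
    case False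
    then obtain e f where ef: "e \<in> A" "f \<in> B" "f \<otimes> (e \<otimes> inv b) \<notin> A" by blast
    define t where "t = e \<otimes> inv b"
    have eG: "e \<in> carrier G" using ef A by blast
    have tG: "t \<in> carrier G" using eG bG by (simp add: t_def)
    have bt: "b \<otimes> t = e" using eG bG by (simp add: t_def m_lcomm[of b e "inv b"])
    define M where "M = {f \<in> B. f \<otimes> t \<notin> A}"
    define A' where "A' = A \<union> (\<lambda>f. f \<otimes> t) ` M"
    define B' where "B' = B - M"
    have MB: "M \<subseteq> B" and finM: "finite M" and fM: "f \<in> M"
      using B ef by (auto simp: M_def t_def)
    have cardB: "card B' + card M = card B" and lt: "card B' < card B"
    proof -
      show "card B' + card M = card B"
        using B MB finM by (simp add: B'_def card_Diff_subset card_mono)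
      show "card B' < card B"
        using B MB fM unfolding B'_def by (intro psubset_card_mono) auto
    qed
    have "inj_on (\<lambda>f. f \<otimes> t) M"
      using MB B tG by (intro inj_onI) (simp add: subset_iff)
    then have cardA: "card A' = card A + card M"
      unfolding A'_def using A finM
      by (subst card_Un_disjoint) (auto simp: M_def card_image)
    have "\<exists>C. C \<subseteq> A' <#> B' \<and> a \<otimes> b \<in> C \<and> card A' + card B' \<le> weight C"
    proof (rule less.hyps[OF lt])
      show "finite A'" "A' \<subseteq> carrier G" "a \<in> A'" "finite B'" "B' \<subseteq> carrier G"
        using A B finM MB tG by (auto simp: A'_def B'_def)
      show "b \<in> B'"
        using B ef bt by (simp add: B'_def M_def)
    qed
    moreover have "A' <#> B' \<subseteq> A <#> B"
    proof
      fix z assume "z \<in> A' <#> B'"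
      then obtain p q where pq: "p \<in> A'" "q \<in> B'" "z = p \<otimes> q"
        by (auto simp: set_mult_mem_iff)
      then have q: "q \<in> B" "q \<otimes> t \<in> A" by (auto simp: B'_def M_def)
      show "z \<in> A <#> B"
      proof (cases "p \<in> A")
        case True
        then show ?thesis using pq q by (auto simp: set_mult_mem_iff)
      next
        case False
        then obtain g where g: "g \<in> B" "p = g \<otimes> t"
          using pq MB by (auto simp: A'_def)
        then have "z = (q \<otimes> t) \<otimes> g"
          using pq q B tG by (simp add: subset_iff m_ac)
        then show ?thesis using g q by (auto simp: set_mult_mem_iff)
      qed
    qed
    moreover have "card A' + card B' = card A + card B"
      using cardA cardB by simp
    ultimately show ?thesis
      by (metis subset_trans)
  qed
qed

theorem kneser:
  assumes A: "finite A" "A \<subseteq> carrier G" "A \<noteq> {}"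
    and B: "finite B" "B \<subseteq> carrier G" "B \<noteq> {}"
  shows "card A + card B \<le> card (A <#> B) + card (period G (A <#> B))"
proof -
  define F where "F = {C. C \<subseteq> A <#> B \<and> C \<noteq> {} \<and> card A + card B \<le> weight C}"
  have fin: "finite (A <#> B)" and sub: "A <#> B \<subseteq> carrier G"
    using A B by (auto simp: finite_set_mult set_mult_closed)
  have cover: "\<exists>C\<in>F. z \<in> C" if z: "z \<in> A <#> B" for z
  proof -
    obtain a b where ab: "a \<in> A" "b \<in> B" "z = a \<otimes> b"
      using z by (auto simp: set_mult_mem_iff)
    with heavy_subset_of_sumset[OF A(1,2) ab(1) B(1,2) ab(2)] show ?thesis
      by (auto simp: F_def)
  qed
  then have U: "\<Union>F = A <#> B"
    by (auto simp: F_def)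
  moreover have "A <#> B \<noteq> {}"
    using A B by (auto simp: set_mult_def)
  moreover have "finite F"
    by (rule finite_subset[of _ "Pow (A <#> B)"]) (auto simp: F_def fin)
  ultimately have "card A + card B \<le> weight (\<Union>F)"
    using fin sub by (intro weight_Union) (auto simp: F_def intro: finite_subset)
  then show ?thesis by (simp add: U weight_def)
qed

section \<open>Three summands\<close>

lemma card_add_card_period_le:
  assumes "finite (carrier G)" "S \<subseteq> carrier G" "S \<noteq> carrier G"
  shows "card S + card (period G S) \<le> card (carrier G)"
proof -
  obtain x where x: "x \<in> carrier G" "x \<notin> S" using assms by blast
  have "x \<otimes> g \<in> carrier G - S" if g: "g \<in> period G S" for g
  proof -
    have gG: "g \<in> carrier G" using g period_subset_carrier by blast
    have "inv g \<in> period G S"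
      using subgroup.m_inv_closed[OF subgroup_period[OF assms(2)] g] .
    then have "x \<otimes> g \<otimes> inv g \<in> S" if "x \<otimes> g \<in> S"
      using that mult_period_closed by blast
    then show ?thesis
      using x gG by (auto simp: m_assoc)
  qed
  then have "card (period G S) \<le> card (carrier G - S)"
    using assms x period_subset_carrier by (intro card_le_of_translate_subset[of _ _ x]) auto
  also have "\<dots> = card (carrier G) - card S"
    using assms finite_subset by (intro card_Diff_subset) auto
  finally show ?thesis
    using card_mono[OF assms(1,2)] by linarith
qed

end

theorem theorem2:
  fixes G :: "('a, 'b) monoid_scheme" (structure)
    and A B C :: "'a set"
  assumes "comm_group G"
    and "finite (carrier G)"
    and "A \<subseteq> carrier G" and "B \<subseteq> carrier G" and "C \<subseteq> carrier G"
    and "A <#> B <#> C \<noteq> carrier G"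
  shows "card A + card B + card C \<le> card (carrier G) + card (period G (A <#> B <#> C))"
proof -
  interpret comm_group G by (rule assms(1))
  note fin = assms(2) and A = assms(3) and B = assms(4) and C = assms(5)
  have finite: "finite A" "finite B" "finite C"
    using A B C by (simp_all add: finite_subset[OF _ fin])
  have AB: "A <#> B \<subseteq> carrier G" "finite (A <#> B)"
    using A B finite by (simp_all add: set_mult_closed finite_set_mult)
  have ABC: "A <#> B <#> C \<subseteq> carrier G"
    using AB C by (simp add: set_mult_closed)
  show ?thesis
  proof (cases "A = {} \<or> B = {} \<or> C = {}")
    case True
    \<comment> \<open>The empty set is invariant under every translation, so its period is the whole group.\<close>
    then have "A <#> B <#> C = {}"
      by (auto simp: set_mult_def)
    then have "period G (A <#> B <#> C) = carrier G"
      by (simp add: period_def r_coset_def)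
    moreover have "card A \<le> card (carrier G)" "card B \<le> card (carrier G)" "card C \<le> card (carrier G)"
      using fin A B C by (simp_all add: card_mono)
    ultimately show ?thesis using True by auto
  next
    case False
    then have ne: "A \<noteq> {}" "B \<noteq> {}" "C \<noteq> {}" "A <#> B \<noteq> {}"
      by (auto simp: set_mult_def)
    have "card A + card B \<le> card (A <#> B) + card (period G (A <#> B))"
      using finite A B ne by (intro kneser)
    moreover have "card (A <#> B) + card C
        \<le> card (A <#> B <#> C) + card (period G (A <#> B <#> C))"
      using finite AB C ne by (intro kneser)
    moreover have "card (period G (A <#> B)) \<le> card (period G (A <#> B <#> C))"
      using period_subset_period_set_mult[OF AB(2) finite(3) AB(1) C] fin period_subset_carrier
      by (meson card_mono finite_subset)
    moreover have "card (A <#> B <#> C) + card (period G (A <#> B <#> C)) \<le> card (carrier G)"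
      using fin ABC assms(6) by (rule card_add_card_period_le)
    ultimately show ?thesis by linarith
  qed
qed

end
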